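(* There exists a rational polytope $Q$ whose Ehrhart quasi-polynomial $\mathcal{L}_Q$ is a polynomial, but such that $\mathcal{L}_Q \neq \mathcal{L}_P$ for every integral polytope $P$. That is, there exist Ehrhart polynomials of rational polytopes that are not the Ehrhart polynomial of any integral polytope.
   Context: A convex rational (respectively, integral) polytope $P \subset \mathbb{R}^n$ is the convex hull of finitely many points of $\mathbb{Q}^n$ (respectively, $\mathbb{Z}^n$); "rational polytope" and "integral polytope" mean such convex polytopes. For a positive integer $k$, $kP = \{x \in \mathbb{R}^n : \tfrac1k x \in P\}$. For a rational polytope $P \subset \mathbb{R}^n$ of dimension $d$ (the dimension of its affine span), Ehrhart's theorem says that there are periodic functions $c_0,\dots,c_d : \mathbb{Z} \to \mathbb{Q}$, with $c_d$ not identically zero, such that $|kP \cap \mathbb{Z}^n| = c_d(k)k^d + \dots + c_1(k)k + c_0(k)$ for all positive integers $k$. This quasi-polynomial function of $k$ is the Ehrhart quasi-polynomial $\mathcal{L}_P$ of $P$. It is called a polynomial (the Ehrhart polynomial of $P$) if the coefficient functions $c_i$ are constant; this is always the case when $P$ is integral. *)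

theory Defs
  imports "HOL-Analysis.Analysis" "HOL-Analysis.Finite_Function_Topology"
begin

text \<open>
  The ambient dimension must be a quantifiable number, so \<open>\<real>\<^sup>n\<close> is modelled as the subspace of
  finitely supported real sequences whose support lies in \<open>{..<n}\<close>.  These sequences form a
  real vector space, so the library notions \<^const>\<open>hull\<close>, \<^const>\<open>convex\<close>, \<^const>\<open>affine\<close> and
  \<^const>\<open>affine_dependent\<close> apply.
\<close>

definition real_space :: "nat \<Rightarrow> (nat \<Rightarrow>\<^sub>0 real) set" where
  "real_space n = {x. Poly_Mapping.keys x \<subseteq> {..<n}}"

definition rational_points :: "nat \<Rightarrow> (nat \<Rightarrow>\<^sub>0 real) set" where
  "rational_points n = {x \<in> real_space n. \<forall>i<n. Poly_Mapping.lookup x i \<in> \<rat>}"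

definition integer_points :: "nat \<Rightarrow> (nat \<Rightarrow>\<^sub>0 real) set" where
  "integer_points n = {x \<in> real_space n. \<forall>i<n. Poly_Mapping.lookup x i \<in> \<int>}"

definition rational_polytope :: "nat \<Rightarrow> (nat \<Rightarrow>\<^sub>0 real) set \<Rightarrow> bool" where
  "rational_polytope n P \<longleftrightarrow> (\<exists>S. finite S \<and> S \<subseteq> rational_points n \<and> P = convex hull S)"

definition integral_polytope :: "nat \<Rightarrow> (nat \<Rightarrow>\<^sub>0 real) set \<Rightarrow> bool" where
  "integral_polytope n P \<longleftrightarrow> (\<exists>S. finite S \<and> S \<subseteq> integer_points n \<and> P = convex hull S)"

text \<open>
  The library's \<^const>\<open>aff_dim\<close> requires a Euclidean space; this is its defining property.
  The empty set has no dimension in this sense.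
\<close>

definition has_affine_dim :: "(nat \<Rightarrow>\<^sub>0 real) set \<Rightarrow> nat \<Rightarrow> bool" where
  "has_affine_dim P d \<longleftrightarrow>
     (\<exists>B. affine hull B = affine hull P \<and> \<not> affine_dependent B \<and> card B = d + 1)"

definition dilate :: "nat \<Rightarrow> nat \<Rightarrow> (nat \<Rightarrow>\<^sub>0 real) set \<Rightarrow> (nat \<Rightarrow>\<^sub>0 real) set" where
  "dilate n k P = {x \<in> real_space n. (1 / real k) *\<^sub>R x \<in> P}"

text \<open>
  The Ehrhart quasi-polynomial as a function on the positive integers: \<^const>\<open>restrict\<close> makes
  equality of two such functions mean agreement at every \<open>k \<ge> 1\<close>.
\<close>

definition ehrhart :: "nat \<Rightarrow> (nat \<Rightarrow>\<^sub>0 real) set \<Rightarrow> nat \<Rightarrow> nat" where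
  "ehrhart n P = (\<lambda>k\<in>{1..}. card (dilate n k P \<inter> integer_points n))"

definition periodic :: "(int \<Rightarrow> rat) \<Rightarrow> bool" where
  "periodic f \<longleftrightarrow> (\<exists>p>0. \<forall>k. f (k + p) = f k)"

definition ehrhart_coefficients ::
    "nat \<Rightarrow> (nat \<Rightarrow>\<^sub>0 real) set \<Rightarrow> nat \<Rightarrow> (nat \<Rightarrow> int \<Rightarrow> rat) \<Rightarrow> bool" where
  "ehrhart_coefficients n P d c \<longleftrightarrow>
     has_affine_dim P d \<and>
     (\<forall>i\<le>d. periodic (c i)) \<and>
     (\<exists>k. c d k \<noteq> 0) \<and>
     (\<forall>k\<ge>1. rat_of_nat (ehrhart n P k) = (\<Sum>i\<le>d. c i (int k) * rat_of_nat k ^ i))"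

text \<open>
  The coefficient functions are uniquely determined, being periodic, so the existential
  quantifier over them is harmless.
\<close>

definition ehrhart_is_polynomial :: "nat \<Rightarrow> (nat \<Rightarrow>\<^sub>0 real) set \<Rightarrow> bool" where
  "ehrhart_is_polynomial n P \<longleftrightarrow>
     (\<exists>d c. ehrhart_coefficients n P d c \<and> (\<forall>i\<le>d. \<forall>k l. c i k = c i l))"

end

theory Submission
  imports Defs
begin

text \<open>
  If an integral polytope contains exactly two lattice points, it is a primitive lattice segment
  and its second dilate contains at most three.  The triangle with vertices \<open>(-1/3, 0)\<close>,
  \<open>(1/3, 0)\<close>, \<open>(0, 3/2)\<close> however has \<open>(k\<^sup>2 + k + 2) / 2\<close> lattice points in its \<open>k\<close>-th
  dilate, hence \<open>2\<close> and \<open>4\<close> for \<open>k = 1, 2\<close>.  Row \<open>j\<close> of the \<open>k\<close>-th dilate has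
  \<open>1 + 2 \<lfloor>(3k - 2j)/9\<rfloor>\<close> lattice points; passing from \<open>k\<close> to \<open>k + 6\<close> adds nine rows, whose
  values \<open>3k - 2j\<close> run through all residues modulo \<open>9\<close>, so the roundings add up to a constant.
\<close>

section \<open>Coordinates and lattice points\<close>

lemma lookup_scaleR: "Poly_Mapping.lookup (r *\<^sub>R x) i = r *\<^sub>R Poly_Mapping.lookup x i"
proof -
  have "finite {i. r *\<^sub>R Poly_Mapping.lookup x i \<noteq> 0}"
    by (rule finite_subset[OF _ finite_lookup[of x]]) auto
  then show ?thesis
    by (simp add: scaleR_poly_mapping_def lookup_Abs_poly_mapping)
qed

lemma real_space_iff: "x \<in> real_space n \<longleftrightarrow> (\<forall>i\<ge>n. Poly_Mapping.lookup x i = 0)"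
  unfolding real_space_def by (auto simp: subset_eq in_keys_iff not_less[symmetric])

lemma convex_real_space: "convex (real_space n)"
  by (auto simp: convex_def real_space_iff lookup_add lookup_scaleR)

lemma integer_points_diff:
  "x \<in> integer_points n \<Longrightarrow> y \<in> integer_points n \<Longrightarrow> x - y \<in> integer_points n"
  by (auto simp: integer_points_def real_space_iff lookup_minus)

lemma ehrhart_1: "P \<subseteq> real_space n \<Longrightarrow> ehrhart n P 1 = card (P \<inter> integer_points n)"
  by (simp add: ehrhart_def dilate_def) (metis Int_absorb1 Int_def)


subsection \<open>Integral polytopes with two lattice points\<close>

text \<open>The generators in \<open>S\<close> are lattice points of \<open>P\<close>, so
  \<open>P\<close> is the segment joining its only two lattice points \<open>u\<close> and
  \<open>v\<close>. A lattice point of the doubled segment, minus a suitable endpoint, is a lattice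
  point of the segment itself.\<close>

lemma integral_polytope_ehrhart_2_le:
  assumes P: "integral_polytope n P" and two: "ehrhart n P 1 = 2"
  shows "ehrhart n P 2 \<le> 3"
proof -
  obtain S where S: "S \<subseteq> integer_points n" "P = convex hull S"
    using P unfolding integral_polytope_def by blast
  have "S \<subseteq> real_space n" using S(1) by (auto simp: integer_points_def)
  then have PR: "P \<subseteq> real_space n"
    unfolding S(2) using convex_real_space by (rule hull_minimal)
  have "card (P \<inter> integer_points n) = 2"
    using two ehrhart_1[OF PR] by simp
  then obtain u v where uv: "P \<inter> integer_points n = {u, v}"
    by (auto simp: card_2_iff)
  have "S \<subseteq> {u, v}"
    using S hull_subset[of S convex] uv by blast
  then have Psub: "P \<subseteq> closed_segment u v"
    unfolding S(2) segment_convex_hull by (rule hull_mono)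
  have "convex P" by (simp add: S(2))
  then have segsub: "closed_segment u v \<subseteq> P"
    using uv by (intro closed_segment_subset) auto
  have lattice: "z \<in> {u, v}" if "z \<in> closed_segment u v" "z \<in> integer_points n" for z
    using that segsub uv by blast
  have u: "u \<in> integer_points n" and v: "v \<in> integer_points n" using uv by auto
  have "dilate n 2 P \<inter> integer_points n \<subseteq> {u + u, u + v, v + v}"
  proof
    fix z assume z: "z \<in> dilate n 2 P \<inter> integer_points n"
    then have "(1/2) *\<^sub>R z \<in> closed_segment u v"
      using Psub by (auto simp: dilate_def)
    then obtain t where t: "0 \<le> t" "t \<le> 1" and "(1/2) *\<^sub>R z = (1 - t) *\<^sub>R u + t *\<^sub>R v"
      by (auto simp: in_segment)
    then have "2 *\<^sub>R ((1/2) *\<^sub>R z) = 2 *\<^sub>R ((1 - t) *\<^sub>R u + t *\<^sub>R v)" by simp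
    then have zt: "z = (2 - 2 * t) *\<^sub>R u + (2 * t) *\<^sub>R v"
      by (simp add: algebra_simps)
    show "z \<in> {u + u, u + v, v + v}"
    \<comment> \<open>The weights of \<open>u\<close> and \<open>v\<close> in \<open>z\<close> add
      up to 2, so one of them is at least 1; subtracting that endpoint once leaves a convex
      combination.\<close>
    proof (cases "2 * t \<le> 1")
      case True
      have "z - u = (1 - 2 * t) *\<^sub>R u + (2 * t) *\<^sub>R v"
        by (simp add: zt algebra_simps scaleR_2)
      then have "z - u \<in> closed_segment u v"
        using True t unfolding in_segment by (intro exI[of _ "2 * t"]) auto
      moreover have "z - u \<in> integer_points n" using z u integer_points_diff by blast
      ultimately have "z - u \<in> {u, v}" by (rule lattice)
      then show ?thesis by (auto simp: diff_eq_eq add.commute)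
    next
      case False
      have "z - v = (1 - (2 * t - 1)) *\<^sub>R u + (2 * t - 1) *\<^sub>R v"
        by (simp add: zt algebra_simps scaleR_2)
      then have "z - v \<in> closed_segment u v"
        using False t unfolding in_segment by (intro exI[of _ "2 * t - 1"]) auto
      moreover have "z - v \<in> integer_points n" using z v integer_points_diff by blast
      ultimately have "z - v \<in> {u, v}" by (rule lattice)
      then show ?thesis by (auto simp: diff_eq_eq)
    qed
  qed
  then have "card (dilate n 2 P \<inter> integer_points n) \<le> card {u + u, u + v, v + v}"
    by (intro card_mono) auto
  also have "\<dots> \<le> 3" by (simp add: card_insert_if)
  finally show ?thesis by (simp add: ehrhart_def)
qed


subsection \<open>Counting lattice points in the triangle\<close>

text \<open>For \<open>m = 3 * k\<close> this will describe the lattice points of the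
  \<open>k\<close>-th dilate. Other \<open>m\<close> are allowed because removing the bottom row
  lowers \<open>m\<close> by 2.\<close>

definition lattice_triangle :: "nat \<Rightarrow> (int \<times> int) set" where
  "lattice_triangle m = {(i, j). 0 \<le> j \<and> 9 * \<bar>i\<bar> \<le> int m - 2 * j}"

lemma finite_lattice_triangle: "finite (lattice_triangle m)"
  by (rule finite_subset[of _ "{- int m..int m} \<times> {0..int m}"])
    (auto simp: lattice_triangle_def)

lemma card_bottom_row: "card {i::int. 9 * \<bar>i\<bar> \<le> int m} = 1 + 2 * (m div 9)"
proof -
  have "{i::int. 9 * \<bar>i\<bar> \<le> int m} = {- int (m div 9)..int (m div 9)}"
    by (auto simp: abs_le_iff zdiv_int)
  then show ?thesis by simp
qed

text \<open>Starting values for the recursion in steps of 2, one for each parity of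
  \<open>m\<close>.\<close>

lemma card_lattice_triangle_small:
  assumes "m < 2"
  shows "card (lattice_triangle m) = 1"
proof -
  have "lattice_triangle m = {(0, 0)}"
    using assms by (auto simp: lattice_triangle_def)
  then show ?thesis by simp
qed

text \<open>The rows \<open>j \<ge> 1\<close> form a copy of the triangle for \<open>m\<close>,
  moved up by one; what remains is the bottom row.\<close>

lemma card_lattice_triangle_step:
  "card (lattice_triangle (m + 2)) = card (lattice_triangle m) + (1 + 2 * ((m + 2) div 9))"
proof -
  let ?shift = "\<lambda>(i, j). (i, j + 1 :: int)"
  let ?row = "(\<lambda>i. (i, 0 :: int)) ` {i. 9 * \<bar>i\<bar> \<le> int (m + 2)}"
  have eq: "lattice_triangle (m + 2) = ?shift ` lattice_triangle m \<union> ?row"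
  proof (intro equalityI subsetI)
    fix p assume p: "p \<in> lattice_triangle (m + 2)"
    obtain i j where ij: "p = (i, j)" by (cases p)
    show "p \<in> ?shift ` lattice_triangle m \<union> ?row"
    proof (cases "j = 0")
      case True
      then show ?thesis using p by (auto simp: ij lattice_triangle_def)
    next
      case False
      then have "(i, j - 1) \<in> lattice_triangle m"
        using p by (auto simp: ij lattice_triangle_def)
      then show ?thesis unfolding ij by (intro UnI1) (rule image_eqI, auto)
    qed
  qed (auto simp: lattice_triangle_def)
  have fin: "finite ?row"
    by (rule finite_subset[OF _ finite_lattice_triangle[of "m + 2"]]) (unfold eq, rule Un_upper2)
  have "card (lattice_triangle (m + 2)) = card (?shift ` lattice_triangle m) + card ?row"
    unfolding eq using fin finite_lattice_triangle
    by (intro card_Un_disjoint) (auto simp: lattice_triangle_def)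
  moreover have "card (?shift ` lattice_triangle m) = card (lattice_triangle m)"
    by (intro card_image) (auto simp: inj_on_def)
  moreover have "card ?row = card {i. 9 * \<bar>i\<bar> \<le> int (m + 2)}"
    by (intro card_image) (auto simp: inj_on_def)
  ultimately show ?thesis by (simp only: card_bottom_row)
qed

text \<open>As 2 is invertible modulo 9, the nine numerators have all residues, which sum to 36. The
  numerators themselves sum to \<open>9 * m + 90\<close>, so the quotients sum to
  \<open>(9 * m + 90 - 36) / 9\<close>.\<close>

lemma sum_div_9: "(\<Sum>i<9. (m + 2 * (i + 1)) div 9) = m + (6::nat)"
proof -
  obtain q r where m: "m = r + 9 * q" "r < 9"
    by (metis add.commute mult_div_mod_eq mod_less_divisor zero_less_numeral)
  \<comment> \<open>The multiple of 9 in \<open>m\<close> comes out of each quotient, which leaves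
    nine values of \<open>r\<close> to evaluate.\<close>
  have "(m + 2 * (i + 1)) div 9 = q + (r + 2 * (i + 1)) div 9" for i
    using div_mult_self2[of 9 "r + 2 * (i + 1)" q] by (simp add: m(1) ac_simps)
  then have "(\<Sum>i<9. (m + 2 * (i + 1)) div 9) = 9 * q + (\<Sum>i<9. (r + 2 * (i + 1)) div 9)"
    by (simp only: sum.distrib sum_constant) simp
  moreover have "r \<in> {0, 1, 2, 3, 4, 5, 6, 7, 8}" using m(2) by auto
  then have "(\<Sum>i<9. (r + 2 * (i + 1)) div 9) = r + 6"
    by (elim insertE emptyE) (simp_all add: lessThan_nat_numeral lessThan_Suc)
  ultimately show ?thesis by (simp add: m(1))
qed

lemma card_lattice_triangle_add:
  "card (lattice_triangle (m + 2 * n)) =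
     card (lattice_triangle m) + (\<Sum>i<n. 1 + 2 * ((m + 2 * (i + 1)) div 9))"
proof (induction n)
  case (Suc n)
  then show ?case
    using card_lattice_triangle_step[of "m + 2 * n"] by (simp add: add.assoc)
qed simp

text \<open>Induction in steps of 6: as \<open>3 * 6 = 2 * 9\<close>, such a step adds exactly the
  nine rows summed in \<open>sum_div_9\<close>.\<close>

lemma card_lattice_triangle: "2 * card (lattice_triangle (3 * k)) = k\<^sup>2 + k + 2"
proof (induction k rule: less_induct)
  case (less k)
  show ?case
  proof (cases "k < 6")
    case True
    then have "k \<in> {0, 1, 2, 3, 4, 5}" by auto
    \<comment> \<open>Each \<open>3 * k\<close> is reached in steps of 2 from 0 if it is even and
      from 1 if it is odd.\<close>
    moreover have "card (lattice_triangle 0) = 1"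
      by (simp add: card_lattice_triangle_small)
    moreover have "card (lattice_triangle 3) = 2"
      using card_lattice_triangle_step[of 1, unfolded one_plus_numeral add_num_simps]
      by (simp add: card_lattice_triangle_small)
    moreover have "card (lattice_triangle 6) = 4"
      "card (lattice_triangle 9) = 7" "card (lattice_triangle 12) = 11"
      "card (lattice_triangle 15) = 16"
      using card_lattice_triangle_add[of 0 3]
        card_lattice_triangle_add[of 1 4] card_lattice_triangle_add[of 0 6]
        card_lattice_triangle_add[of 1 7]
      by (simp_all add: card_lattice_triangle_small lessThan_nat_numeral lessThan_Suc)
    ultimately show ?thesis by auto
  next
    case False
    define l where "l = k - 6"
    have k: "k = l + 6" using False by (simp add: l_def)
    \<comment> \<open>Each of the nine added rows has one point with \<open>i = 0\<close>, which
      gives the 9; the other points come in pairs, and \<open>sum_div_9\<close> counts the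
      pairs.\<close>
    have "card (lattice_triangle (3 * k)) = card (lattice_triangle (3 * l)) + (9 + 2 * (3 * l + 6))"
      using card_lattice_triangle_add[of "3 * l" 9]
      unfolding k sum.distrib sum_distrib_left[symmetric] sum_div_9 by simp
    moreover have "2 * card (lattice_triangle (3 * l)) = l\<^sup>2 + l + 2"
      by (rule less.IH) (simp add: k)
    ultimately show ?thesis
      by (simp add: k power2_eq_square algebra_simps)
  qed
qed


subsection \<open>The triangle\<close>

definition plane_point :: "real \<Rightarrow> real \<Rightarrow> nat \<Rightarrow>\<^sub>0 real" where
  "plane_point x y = Poly_Mapping.single 0 x + Poly_Mapping.single 1 y"

lemma lookup_plane_point:
  "Poly_Mapping.lookup (plane_point x y) i = (if i = 0 then x else if i = 1 then y else 0)"
  by (simp add: plane_point_def lookup_add lookup_single when_def)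

lemma plane_point_eq_iff [simp]: "plane_point x y = plane_point x' y' \<longleftrightarrow> x = x' \<and> y = y'"
  by (auto simp: poly_mapping_eq_iff fun_eq_iff lookup_plane_point)

lemma plane_point_add [simp]:
  "plane_point x y + plane_point x' y' = plane_point (x + x') (y + y')"
  by (rule poly_mapping_eqI) (simp add: lookup_plane_point lookup_add)

lemma plane_point_scaleR [simp]: "r *\<^sub>R plane_point x y = plane_point (r * x) (r * y)"
  by (rule poly_mapping_eqI) (simp add: lookup_plane_point lookup_scaleR)

lemma plane_point_eq_0_iff [simp]: "plane_point x y = 0 \<longleftrightarrow> x = 0 \<and> y = 0"
  by (auto simp: poly_mapping_eq_iff fun_eq_iff lookup_plane_point)

lemma plane_point_in_real_space [simp]: "plane_point x y \<in> real_space 2"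
  by (simp add: real_space_iff lookup_plane_point)

lemma real_space_2_cases:
  assumes "z \<in> real_space 2"
  obtains x y where "z = plane_point x y"
proof
  show "z = plane_point (Poly_Mapping.lookup z 0) (Poly_Mapping.lookup z 1)"
    using assms by (intro poly_mapping_eqI) (auto simp: real_space_iff lookup_plane_point)
qed

lemma less_2_all: "(\<forall>i<2. P i) \<longleftrightarrow> P 0 \<and> P (1::nat)"
  by (auto simp: less_2_cases_iff)

lemma plane_point_in_integer_points [simp]:
  "plane_point x y \<in> integer_points 2 \<longleftrightarrow> x \<in> \<int> \<and> y \<in> \<int>"
  by (simp add: integer_points_def less_2_all lookup_plane_point)

lemma plane_point_in_rational_points [simp]:
  "plane_point x y \<in> rational_points 2 \<longleftrightarrow> x \<in> \<rat> \<and> y \<in> \<rat>"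
  by (simp add: rational_points_def less_2_all lookup_plane_point)

text \<open>The area is 1/2, which is the leading coefficient of the Ehrhart polynomial.\<close>

definition triangle_vertices :: "(nat \<Rightarrow>\<^sub>0 real) set" where
  "triangle_vertices = {plane_point (- 1 / 3) 0, plane_point (1 / 3) 0, plane_point 0 (3 / 2)}"

lemma plane_point_in_triangle_iff:
  "plane_point x y \<in> convex hull triangle_vertices \<longleftrightarrow> 0 \<le> y \<and> 9 * \<bar>x\<bar> \<le> 3 - 2 * y"
proof -
  have "plane_point x y \<in> convex hull triangle_vertices \<longleftrightarrow>
      (\<exists>u v w. 0 \<le> u \<and> 0 \<le> v \<and> 0 \<le> w \<and> u + v + w = 1 \<and> x = (v - u) / 3 \<and> y = 3 * w / 2)"
    unfolding triangle_vertices_def convex_hull_3 by (auto simp: field_simps)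
  also have "\<dots> \<longleftrightarrow> 0 \<le> y \<and> 9 * \<bar>x\<bar> \<le> 3 - 2 * y"
  proof
    assume "0 \<le> y \<and> 9 * \<bar>x\<bar> \<le> 3 - 2 * y"
    \<comment> \<open>Barycentric coordinates: \<open>y\<close> determines
      \<open>w = 2 * y / 3\<close>, and then \<open>u + v = 1 - w\<close> and
      \<open>v - u = 3 * x\<close> are solved for \<open>u\<close> and \<open>v\<close>. The bound
      on the absolute value of \<open>x\<close> says that both are nonnegative.\<close>
    then show "\<exists>u v w. 0 \<le> u \<and> 0 \<le> v \<and> 0 \<le> w \<and> u + v + w = 1 \<and> x = (v - u) / 3 \<and> y = 3 * w / 2"
      by (intro exI[of _ "(1 - 2 * y / 3 - 3 * x) / 2"] exI[of _ "(1 - 2 * y / 3 + 3 * x) / 2"]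
          exI[of _ "2 * y / 3"]) (auto simp: field_simps abs_le_iff)
  qed (auto simp: abs_le_iff field_simps)
  finally show ?thesis .
qed

text \<open>Multiplying the inequalities of the triangle by \<open>k > 0\<close> turns the constant
  3 into the parameter \<open>3 * k\<close>.\<close>

lemma dilate_triangle_integer_points:
  assumes "k \<ge> 1"
  shows "dilate 2 k (convex hull triangle_vertices) \<inter> integer_points 2 =
    (\<lambda>(i, j). plane_point (of_int i) (of_int j)) ` lattice_triangle (3 * k)"
proof -
  have mem: "(1 / real k) *\<^sub>R plane_point (of_int i) (of_int j) \<in> convex hull triangle_vertices \<longleftrightarrow>
      (i, j) \<in> lattice_triangle (3 * k)" for i j :: int
  proof -
    have "(1 / real k) *\<^sub>R plane_point (of_int i) (of_int j) \<in> convex hull triangle_vertices \<longleftrightarrow>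
        0 \<le> real_of_int j \<and> 9 * \<bar>real_of_int i\<bar> \<le> 3 * real k - 2 * of_int j"
      using assms by (simp add: plane_point_in_triangle_iff abs_mult field_simps)
    also have "\<dots> \<longleftrightarrow> 0 \<le> real_of_int j \<and>
        real_of_int (9 * \<bar>i\<bar>) \<le> real_of_int (int (3 * k) - 2 * j)"
      by simp
    also have "\<dots> \<longleftrightarrow> (i, j) \<in> lattice_triangle (3 * k)"
      unfolding of_int_le_iff by (simp add: lattice_triangle_def)
    finally show ?thesis .
  qed
  show ?thesis
  proof (intro equalityI subsetI)
    fix z assume z: "z \<in> dilate 2 k (convex hull triangle_vertices) \<inter> integer_points 2"
    then obtain x y where xy: "z = plane_point x y"
      by (auto simp: dilate_def elim: real_space_2_cases)
    with z obtain i j where "x = of_int i" "y = of_int j"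
      by (auto elim!: Ints_cases)
    with z xy mem show "z \<in> (\<lambda>(i, j). plane_point (of_int i) (of_int j)) ` lattice_triangle (3 * k)"
      by (auto simp: dilate_def simp del: plane_point_scaleR)
  qed (auto simp: dilate_def mem simp del: plane_point_scaleR)
qed

lemma ehrhart_triangle:
  assumes "k \<ge> 1"
  shows "2 * ehrhart 2 (convex hull triangle_vertices) k = k\<^sup>2 + k + 2"
proof -
  have "card ((\<lambda>(i, j). plane_point (of_int i) (of_int j)) ` lattice_triangle (3 * k)) =
      card (lattice_triangle (3 * k))"
    by (intro card_image) (auto simp: inj_on_def)
  then show ?thesis
    using assms by (simp add: ehrhart_def dilate_triangle_integer_points card_lattice_triangle)
qed

section \<open>Dimension and Ehrhart polynomial of the triangle\<close>

lemma has_affine_dim_triangle: "has_affine_dim (convex hull triangle_vertices) 2"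
proof -
  have "\<not> affine_dependent triangle_vertices"
    \<comment> \<open>In a vanishing combination with coefficient sum 0, the second coordinate kills
      the weight of the apex; the first makes the other two weights equal, and the sum makes them
      opposite.\<close>
    by (auto simp: affine_dependent_explicit_finite triangle_vertices_def)
  moreover have "card triangle_vertices = 2 + 1"
    by (simp add: triangle_vertices_def)
  ultimately show ?thesis
    unfolding has_affine_dim_def by (intro exI[of _ triangle_vertices]) simp
qed

lemma ehrhart_is_polynomial_triangle: "ehrhart_is_polynomial 2 (convex hull triangle_vertices)"
proof -
  \<comment> \<open>The coefficients of \<open>(k^2 + k + 2) / 2\<close>, as constant functions and
    hence of period 1.\<close>
  define c :: "nat \<Rightarrow> int \<Rightarrow> rat" where "c = (\<lambda>i _. if i = 0 then 1 else 1 / 2)"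
  have "rat_of_nat (ehrhart 2 (convex hull triangle_vertices) k) =
      (\<Sum>i\<le>2. c i (int k) * rat_of_nat k ^ i)" if "k \<ge> 1" for k
  proof -
    have "2 * rat_of_nat (ehrhart 2 (convex hull triangle_vertices) k) =
        rat_of_nat (2 * ehrhart 2 (convex hull triangle_vertices) k)" by simp
    also have "\<dots> = rat_of_nat k ^ 2 + rat_of_nat k + 2"
      unfolding ehrhart_triangle[OF that] by simp
    finally show ?thesis
      by (simp add: c_def eval_nat_numeral field_simps)
  qed
  then have "ehrhart_coefficients 2 (convex hull triangle_vertices) 2 c"
    by (auto simp: ehrhart_coefficients_def has_affine_dim_triangle periodic_def c_def
        intro: exI[of _ 1])
  then show ?thesis
    unfolding ehrhart_is_polynomial_def by (intro exI[of _ 2] exI[of _ c]) (simp add: c_def)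
qed

theorem mainTheorem1:
  shows "\<exists>n Q. rational_polytope n Q \<and> ehrhart_is_polynomial n Q \<and>
           (\<forall>m P. integral_polytope m P \<longrightarrow> ehrhart n Q \<noteq> ehrhart m P)"
proof (intro exI conjI allI impI)
  show "rational_polytope 2 (convex hull triangle_vertices)"
    unfolding rational_polytope_def
    by (intro exI[of _ triangle_vertices]) (simp add: triangle_vertices_def)
  show "ehrhart_is_polynomial 2 (convex hull triangle_vertices)"
    by (rule ehrhart_is_polynomial_triangle)
  fix m P assume P: "integral_polytope m P"
  show "ehrhart 2 (convex hull triangle_vertices) \<noteq> ehrhart m P"
  proof
    assume "ehrhart 2 (convex hull triangle_vertices) = ehrhart m P"
    \<comment> \<open>The values of \<open>(k^2 + k + 2) / 2\<close> at 1 and 2; the second exceeds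
      the bound 3, whatever the ambient dimension \<open>m\<close>.\<close>
    then have "ehrhart m P 1 = 2" "ehrhart m P 2 = 4"
      using ehrhart_triangle[of 1] ehrhart_triangle[of 2] by simp_all
    with integral_polytope_ehrhart_2_le[OF P] show False by simp
  qed
qed

end
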